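(* There exists a two-sided adaptive tester for $2$-monotonicity of functions $f\colon[n]^2\to\{0,1\}$ with query complexity $q(n,\varepsilon)=O(1/\varepsilon)$.
   Context: $[n]^2$ is ordered coordinatewise: $(i,j)\preceq(i',j')$ iff $i\leq i'$ and $j\leq j'$. A function $f\colon[n]^2\to\{0,1\}$ is $2$-monotone if there do not exist $x_1\preceq x_2\preceq x_3$ with $f(x_1)=1,f(x_2)=0,f(x_3)=1$. Distance is normalized Hamming distance. A tester, given $\varepsilon$ and query access to $f$, accepts $2$-monotone $f$ with probability at least $2/3$ and rejects $f$ that is $\varepsilon$-far from $2$-monotone with probability at least $2/3$; it may err on both sides and its queries may depend on previous answers. *)

theory Defs
  imports "HOL-Probability.Probability"
begin

text \<open>Points of the grid [n]^2 are pairs of naturals in {1..n} x {1..n}.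
  Boolean functions are modelled as f :: nat \<times> nat \<Rightarrow> bool (True = 1, False = 0);
  only their values on the grid matter.\<close>

definition grid :: "nat \<Rightarrow> (nat \<times> nat) set" where
  "grid n = {1..n} \<times> {1..n}"

definition pleq :: "nat \<times> nat \<Rightarrow> nat \<times> nat \<Rightarrow> bool" where
  "pleq x y \<longleftrightarrow> fst x \<le> fst y \<and> snd x \<le> snd y"

definition two_monotone :: "nat \<Rightarrow> (nat \<times> nat \<Rightarrow> bool) \<Rightarrow> bool" where
  "two_monotone n f \<longleftrightarrow>
     \<not> (\<exists>x1\<in>grid n. \<exists>x2\<in>grid n. \<exists>x3\<in>grid n.
          pleq x1 x2 \<and> pleq x2 x3 \<and> f x1 \<and> \<not> f x2 \<and> f x3)"

definition hdist :: "nat \<Rightarrow> (nat \<times> nat \<Rightarrow> bool) \<Rightarrow> (nat \<times> nat \<Rightarrow> bool) \<Rightarrow> real" where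
  "hdist n f g = real (card {x \<in> grid n. f x \<noteq> g x}) / real (card (grid n))"

definition far_from_two_monotone :: "nat \<Rightarrow> real \<Rightarrow> (nat \<times> nat \<Rightarrow> bool) \<Rightarrow> bool" where
  "far_from_two_monotone n \<epsilon> f \<longleftrightarrow> (\<forall>g. two_monotone n g \<longrightarrow> hdist n f g \<ge> \<epsilon>)"

text \<open>Deterministic adaptive query algorithms = decision trees: each internal node
  queries a point and branches on the answer; leaves output accept (True) / reject.\<close>
datatype 'a dtree = Leaf bool | Query 'a "bool \<Rightarrow> 'a dtree"

primrec run :: "('a \<Rightarrow> bool) \<Rightarrow> 'a dtree \<Rightarrow> bool" where
  "run f (Leaf b) = b"
| "run f (Query x t) = run f (t (f x))"

primrec num_queries :: "('a \<Rightarrow> bool) \<Rightarrow> 'a dtree \<Rightarrow> nat" where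
  "num_queries f (Leaf b) = 0"
| "num_queries f (Query x t) = Suc (num_queries f (t (f x)))"

primrec queries_within :: "'a set \<Rightarrow> ('a \<Rightarrow> bool) \<Rightarrow> 'a dtree \<Rightarrow> bool" where
  "queries_within A f (Leaf b) = True"
| "queries_within A f (Query x t) = (x \<in> A \<and> queries_within A f (t (f x)))"

text \<open>A randomized adaptive (two-sided) tester is, for each n and \<epsilon>, a probability
  distribution over decision trees.\<close>
definition is_two_monotone_tester ::
  "(nat \<Rightarrow> real \<Rightarrow> (nat \<times> nat) dtree pmf) \<Rightarrow> bool" where
  "is_two_monotone_tester T \<longleftrightarrow>
     (\<forall>n \<epsilon>. 0 < \<epsilon> \<and> \<epsilon> \<le> 1 \<longrightarrow>
        (\<forall>t\<in>set_pmf (T n \<epsilon>). \<forall>f. queries_within (grid n) f t) \<and>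
        (\<forall>f. two_monotone n f \<longrightarrow> measure_pmf.prob (T n \<epsilon>) {t. run f t} \<ge> 2/3) \<and>
        (\<forall>f. far_from_two_monotone n \<epsilon> f \<longrightarrow>
              measure_pmf.prob (T n \<epsilon>) {t. \<not> run f t} \<ge> 2/3))"

definition query_bound ::
  "(nat \<Rightarrow> real \<Rightarrow> (nat \<times> nat) dtree pmf) \<Rightarrow> (nat \<Rightarrow> real \<Rightarrow> real) \<Rightarrow> bool" where
  "query_bound T q \<longleftrightarrow>
     (\<forall>n \<epsilon>. 0 < \<epsilon> \<and> \<epsilon> \<le> 1 \<longrightarrow>
        (\<forall>t\<in>set_pmf (T n \<epsilon>). \<forall>f. real (num_queries f t) \<le> q n \<epsilon>))"

end

theory Submission
  imports Defs
begin

text \<open>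
  Blow \<open>f\<close> up to a square of side \<open>n M\<close>, with \<open>M\<close> of order \<open>1/\<epsilon>\<close>, and cut it into \<open>M\<^sup>2\<close> cells of
  side \<open>n\<close>. If \<open>f\<close> is 2-monotone, a strictly increasing chain of cells contains at most two on
  which \<open>f\<close> is not constant, so all but \<open>O(M)\<close> cells are constant, and the set \<open>S\<close> of cells whose
  lower left corner is a one is order-convex. It therefore suffices to find, with \<open>O(M)\<close> queries,
  points \<open>P \<subseteq> S\<close> such that the expected number of elements of \<open>S\<close> not above a point of \<open>P\<close> is
  \<open>O(M)\<close>: doing the same after reflecting the board gives \<open>Q\<close>, and the order-convex set of cells
  above a point of \<open>P\<close> and below a point of \<open>Q\<close> is then compared with \<open>f\<close> at \<open>O(1/\<epsilon>)\<close> random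
  points. This guess is 2-monotone whatever \<open>f\<close> is, hence soundness.

  \<open>P\<close> is found by sweeping from the upper left to the lower right corner of the board. If all
  columns left of \<open>x\<close> and all rows above \<open>y\<close> are settled, query one random point of each L-shaped
  shell of radius \<open>R = 0, 1, 2, \<dots>\<close> around \<open>(x, y)\<close> until a one is hit. Giving up the elements of
  \<open>S\<close> in the shell of radius \<open>R\<close>, which has \<open>2 R + 1\<close> points, costs \<open>(2 R + 1) p\<close>, where \<open>p\<close> is the
  probability of a hit; as a hit moves the corner by at least \<open>R + 1\<close> in the \<open>\<ell>\<^sub>1\<close> distance, the
  expected loss is at most twice the total distance. After a hit in column \<open>i\<close>, the lower boundary
  of \<open>S\<close> in the columns up to \<open>i\<close> is traced deterministically: from \<open>(x, b)\<close>, move down on a one and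
  right on a zero. By convexity a zero at \<open>(a, b)\<close> below the one at \<open>(i, b + 1)\<close> rules out
  everything below \<open>(a, b)\<close>, so when column \<open>i\<close> is passed the sweep resumes from corner
  \<open>(i + 1, b)\<close>.
\<close>

subsection \<open>Randomized decision trees\<close>

text \<open>The subtrees for both answers are drawn in advance, since a tester is a distribution
  over whole trees; a run follows only one of them.\<close>

definition rquery :: "'a \<Rightarrow> (bool \<Rightarrow> 'a dtree pmf) \<Rightarrow> 'a dtree pmf" where
  "rquery x D = bind_pmf (D True) (\<lambda>t1. bind_pmf (D False) (\<lambda>t0.
     return_pmf (Query x (\<lambda>b. if b then t1 else t0))))"

definition rej :: "('a \<Rightarrow> bool) \<Rightarrow> 'a dtree pmf \<Rightarrow> real" where
  "rej f D = pmf (map_pmf (run f) D) False"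

lemma prob_reject: "measure_pmf.prob D {t. \<not> run f t} = rej f D"
  by (simp add: rej_def pmf_map vimage_def)

lemma prob_accept: "measure_pmf.prob D {t. run f t} = 1 - rej f D"
proof -
  have "measure_pmf.prob D (space (measure_pmf D) - {t. \<not> run f t}) = 1 - measure_pmf.prob D {t. \<not> run f t}"
    by (rule measure_pmf.prob_compl) simp
  moreover have "space (measure_pmf D) - {t. \<not> run f t} = {t. run f t}"
    by auto
  ultimately show ?thesis
    by (simp add: prob_reject)
qed

lemma rej_return [simp]: "rej f (return_pmf t) = (if run f t then 0 else 1)"
  by (simp add: rej_def)

lemma rej_rquery [simp]: "rej f (rquery x D) = rej f (D (f x))"
  by (cases "f x") (simp_all add: rej_def rquery_def map_bind_pmf map_pmf_def[symmetric] pmf.map_comp o_def bind_return_pmf bind_pmf_const bind_assoc_pmf)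

lemma rej_bind_pmf_of_set:
  assumes "finite A" "A \<noteq> {}"
  shows "rej f (bind_pmf (pmf_of_set A) D) = (\<Sum>z\<in>A. rej f (D z)) / real (card A)"
  using assms by (simp add: rej_def map_bind_pmf pmf_bind_pmf_of_set)

definition admissible :: "'a set \<Rightarrow> nat \<Rightarrow> 'a dtree pmf \<Rightarrow> bool" where
  "admissible A q D \<longleftrightarrow> (\<forall>t\<in>set_pmf D. \<forall>f. queries_within A f t \<and> num_queries f t \<le> q)"

lemma admissible_return [simp]: "admissible A q (return_pmf (Leaf b))"
  by (simp add: admissible_def)

lemma admissible_mono: "admissible A q D \<Longrightarrow> q \<le> q' \<Longrightarrow> admissible A q' D"
  unfolding admissible_def using le_trans by blast

lemma admissible_bind:
  "(\<And>z. z \<in> set_pmf p \<Longrightarrow> admissible A q (D z)) \<Longrightarrow> admissible A q (bind_pmf p D)"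
  by (auto simp: admissible_def)

lemma admissible_rquery:
  assumes "x \<in> A" "\<And>b. admissible A q (D b)"
  shows "admissible A (Suc q) (rquery x D)"
  using assms(1) assms(2)[of True] assms(2)[of False] by (auto simp: admissible_def rquery_def)

subsection \<open>Sweeping the lower boundary of a convex set\<close>

text \<open>\<open>Shell x y R\<close> searches at radius \<open>R\<close> from the corner \<open>(x, y)\<close>; \<open>Walk i a b\<close> traces the boundary
  at \<open>(a, b)\<close>, knowing that \<open>(i, b + 1)\<close> is a one.\<close>

datatype phase = Shell int int int | Walk int int int

fun probes :: "phase \<Rightarrow> (int \<times> int) set" where
  "probes (Shell x y R) = {x + R} \<times> {y - R..y} \<union> {x..<x + R} \<times> {y - R}"
| "probes (Walk i a b) = {(a, b)}"

fun advance :: "phase \<Rightarrow> int \<times> int \<Rightarrow> bool \<Rightarrow> phase" where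
  "advance (Shell x y R) z hit = (if hit then Walk (fst z) x (snd z - 1) else Shell x y (R + 1))"
| "advance (Walk i a b) z hit =
     (if hit then Walk i a (b - 1) else if a < i then Walk i (a + 1) b else Shell (i + 1) b 0)"

text \<open>Distance from the corner to \<open>(M + 1, 0)\<close>, where the sweep ends; in a walk,
  from the corner \<open>(i + 1, b)\<close> at which the sweep would resume.\<close>

fun potential :: "int \<Rightarrow> phase \<Rightarrow> int" where
  "potential M (Shell x y R) = M + 1 - x + y"
| "potential M (Walk i a b) = M - i + b"

text \<open>Bounds the number of remaining probes. The factor 2 lets the advance of the corner pay
  for the failed shells before a hit and for the steps to the right after it.\<close>

fun fuel_needed :: "int \<Rightarrow> phase \<Rightarrow> int" where
  "fuel_needed M (Shell x y R) = 2 * (M + 1 - x + y) - R"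
| "fuel_needed M (Walk i a b) = 2 * (M - i + b) + (i - a + 1)"

text \<open>The elements of \<open>S\<close> not yet settled, that is, neither above a known one nor given up.\<close>

fun pending :: "(int \<times> int) set \<Rightarrow> phase \<Rightarrow> (int \<times> int) set" where
  "pending S (Shell x y R) = {z \<in> S. x \<le> fst z \<and> snd z \<le> y \<and> (x + R \<le> fst z \<or> snd z \<le> y - R)}"
| "pending S (Walk i a b) = {z \<in> S. a \<le> fst z \<and> snd z \<le> b}"

fun valid :: "int \<Rightarrow> (int \<times> int) set \<Rightarrow> phase \<Rightarrow> bool" where
  "valid M S (Shell x y R) \<longleftrightarrow> 0 \<le> R \<and> x \<le> M + 1 \<and> 0 \<le> y"
| "valid M S (Walk i a b) \<longleftrightarrow> (i, b + 1) \<in> S \<and> a \<le> i"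

definition board :: "int \<Rightarrow> (int \<times> int) set" where
  "board M = {1..M} \<times> {1..M}"

definition order_convex :: "(int \<times> int) set \<Rightarrow> bool" where
  "order_convex S \<longleftrightarrow> (\<forall>u\<in>S. \<forall>w\<in>S. \<forall>v. u \<le> v \<and> v \<le> w \<longrightarrow> v \<in> S)"

definition missed :: "(int \<times> int) set \<Rightarrow> (int \<times> int) set \<Rightarrow> (int \<times> int) set" where
  "missed U P = {z \<in> U. \<not> (\<exists>p\<in>P. p \<le> z)}"

text \<open>Probes may leave the board; there the answer is zero, at no cost.\<close>

definition ask :: "int \<Rightarrow> (int \<times> int \<Rightarrow> 'a) \<Rightarrow> int \<times> int \<Rightarrow> (bool \<Rightarrow> 'a dtree pmf) \<Rightarrow> 'a dtree pmf" where
  "ask M \<rho> z D = (if z \<in> board M then rquery (\<rho> z) D else D False)"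

text \<open>The continuation \<open>K\<close> allows the second sweep and the final check to be
  nested inside the first.\<close>

primrec learn :: "int \<Rightarrow> (int \<times> int \<Rightarrow> 'a) \<Rightarrow> ((int \<times> int) set \<Rightarrow> 'a dtree pmf) \<Rightarrow> nat \<Rightarrow> phase
    \<Rightarrow> (int \<times> int) set \<Rightarrow> 'a dtree pmf" where
  "learn M \<rho> K 0 s P = K P"
| "learn M \<rho> K (Suc k) s P = bind_pmf (pmf_of_set (probes s)) (\<lambda>z.
     ask M \<rho> z (\<lambda>b. learn M \<rho> K k (advance s z b) (if b then insert z P else P)))"

lemma rej_ask: "rej f (ask M \<rho> z D) = rej f (D (z \<in> board M \<and> f (\<rho> z)))"
  by (simp add: ask_def)

lemma finite_probes [simp]: "finite (probes s)"
  by (cases s) auto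

lemma probes_nonempty: "valid M S s \<Longrightarrow> probes s \<noteq> {}"
  by (cases s) auto


lemma card_probes_Shell:
  assumes "0 \<le> R"
  shows "real (card (probes (Shell x y R))) = 2 * R + 1"
proof -
  have "card (probes (Shell x y R)) = card ({x + R} \<times> {y - R..y}) + card ({x..<x + R} \<times> {y - R})"
    unfolding probes.simps by (rule card_Un_disjoint) auto
  then show ?thesis
    using assms by simp
qed

lemma order_convexD: "order_convex S \<Longrightarrow> u \<in> S \<Longrightarrow> w \<in> S \<Longrightarrow> u \<le> v \<Longrightarrow> v \<le> w \<Longrightarrow> v \<in> S"
  unfolding order_convex_def by blast

text \<open>When a walk moves down, convexity supplies the next known one: \<open>(i, b)\<close>
  lies between \<open>(a, b)\<close> and \<open>(i, b + 1)\<close>.\<close>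

lemma valid_advance:
  assumes "S \<subseteq> board M" "order_convex S" "valid M S s" "z \<in> probes s"
  shows "valid M S (advance s z (z \<in> S))"
proof (cases s)
  case (Shell x y R)
  then show ?thesis
    using assms by (auto simp: board_def)
next
  case (Walk i a b)
  have "(i, b) \<in> S" if "(a, b) \<in> S"
    using order_convexD[OF assms(2) that, of "(i, b + 1)" "(i, b)"] assms(3) Walk by simp
  moreover have "i \<le> M" "0 \<le> b"
    using assms(1,3) Walk by (auto simp: board_def)
  ultimately show ?thesis
    using assms Walk by auto
qed

lemma fuel_needed_advance:
  assumes "valid M S s" "z \<in> probes s"
  shows "fuel_needed M (advance s z hit) + 1 \<le> fuel_needed M s"
  using assms by (cases s) (auto split: if_splits)

text \<open>A shell point differs from the corner by \<open>R\<close> in some coordinate. Twice the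
  drop covers the \<open>2 * R + 1\<close> points of the shell.\<close>

lemma potential_hit_Shell:
  assumes "z \<in> probes (Shell x y R)"
  shows "potential M (advance (Shell x y R) z True) + (R + 1) \<le> potential M (Shell x y R)"
  using assms by auto

lemma potential_advance_Walk:
  "potential M (advance (Walk i a b) z hit) \<le> potential M (Walk i a b)"
  by auto

lemma potential_nonneg: "S \<subseteq> board M \<Longrightarrow> valid M S s \<Longrightarrow> 0 \<le> potential M s"
  by (cases s) (auto simp: board_def)

lemma pending_subset: "pending S s \<subseteq> S"
  by (cases s) auto

text \<open>Without fuel, the radius of a shell reaches past the board in both directions; a valid
  walk always has positive fuel.\<close>

lemma pending_empty:
  assumes "S \<subseteq> board M" "valid M S s" "fuel_needed M s \<le> 0"
  shows "pending S s = {}"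
proof (cases s)
  case (Shell x y R)
  then show ?thesis
    using assms by (force simp: board_def)
next
  case (Walk i a b)
  then show ?thesis
    using assms by (force simp: board_def)
qed

text \<open>After a hit at \<open>z\<close>, a pending element left of \<open>z\<close> and not
  below its row can only lie on the lower edge of the shell. After a zero, only the shell itself is
  dropped.\<close>

lemma missed_Shell:
  assumes "z \<in> probes (Shell x y R)" "z \<in> S \<Longrightarrow> z \<in> P"
  shows "missed (pending S (Shell x y R)) P
    \<subseteq> S \<inter> probes (Shell x y R) \<union> missed (pending S (advance (Shell x y R) z (z \<in> S))) P"
proof
  fix w assume w: "w \<in> missed (pending S (Shell x y R)) P"
  obtain w1 w2 z1 z2 where [simp]: "w = (w1, w2)" "z = (z1, z2)"
    by fastforce
  have "\<not> z \<le> w" if "z \<in> S"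
    using w assms(2)[OF that] by (auto simp: missed_def)
  then show "w \<in> S \<inter> probes (Shell x y R)
      \<union> missed (pending S (advance (Shell x y R) z (z \<in> S))) P"
    using w assms(1) by (auto simp: missed_def)
qed

lemma missed_Walk:
  assumes "order_convex S" "valid M S (Walk i a b)" "(a, b) \<in> S \<Longrightarrow> (a, b) \<in> P"
  shows "missed (pending S (Walk i a b)) P
    \<subseteq> missed (pending S (advance (Walk i a b) z ((a, b) \<in> S))) P"
proof
  fix w assume w: "w \<in> missed (pending S (Walk i a b)) P"
  obtain w1 w2 where [simp]: "w = (w1, w2)"
    by fastforce
  have 1: "\<not> (a, b) \<le> w" if "(a, b) \<in> S"
    using w assms(3)[OF that] by (auto simp: missed_def)
  have 2: "\<not> w \<le> (a, b)" if "(a, b) \<notin> S"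
    using order_convexD[OF assms(1), of w "(i, b + 1)" "(a, b)"] w assms(2) that
    by (auto simp: missed_def)
  show "w \<in> missed (pending S (advance (Walk i a b) z ((a, b) \<in> S))) P"
    using w 1 2 by (auto simp: missed_def)
qed

text \<open>\<open>\<alpha>\<close> is general so that the induction can add to it the elements of \<open>S\<close> given up in a shell.\<close>

lemma rej_learn:
  assumes S: "S = {z \<in> board M. f (\<rho> z)}" and conv: "order_convex S" and "0 \<le> \<beta>"
    and "valid M S s" "fuel_needed M s \<le> int k" "P \<subseteq> S"
    and "\<And>P'. P \<subseteq> P' \<Longrightarrow> P' \<subseteq> S \<Longrightarrow>
           rej f (K P') \<le> \<alpha> + \<beta> * real (card (missed (pending S s) P'))"
  shows "rej f (learn M \<rho> K k s P) \<le> \<alpha> + \<beta> * (2 * potential M s)"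
  using assms(4-)
proof (induction k arbitrary: s P \<alpha>)
  case 0
  have "S \<subseteq> board M"
    using S by auto
  then have "pending S s = {}" "0 \<le> potential M s"
    using 0 pending_empty potential_nonneg by auto
  moreover have "rej f (K P) \<le> \<alpha> + \<beta> * real (card (missed (pending S s) P))"
    using 0 by blast
  ultimately show ?case
    using \<open>0 \<le> \<beta>\<close> by (simp add: missed_def) (smt (verit) mult_nonneg_nonneg of_int_0_le_iff)
next
  case (Suc k)
  have sub: "S \<subseteq> board M"
    using S by auto
  then have fin: "finite S"
    by (rule finite_subset) (simp add: board_def)
  let ?next = "\<lambda>z. learn M \<rho> K k (advance s z (z \<in> S)) (if z \<in> S then insert z P else P)"
  have eq: "rej f (learn M \<rho> K (Suc k) s P) = (\<Sum>z\<in>probes s. rej f (?next z)) / real (card (probes s))"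
    using probes_nonempty[OF Suc.prems(1)]
    by (simp add: rej_bind_pmf_of_set rej_ask S)
  have IH: "rej f (?next z) \<le> \<alpha>' + \<beta> * (2 * potential M (advance s z (z \<in> S)))"
    if z: "z \<in> probes s" and "\<And>P'. P' \<subseteq> S \<Longrightarrow> (z \<in> S \<longrightarrow> z \<in> P') \<Longrightarrow>
        \<alpha> + \<beta> * real (card (missed (pending S s) P'))
        \<le> \<alpha>' + \<beta> * real (card (missed (pending S (advance s z (z \<in> S))) P'))" for z \<alpha>'
  proof (rule Suc.IH)
    show "valid M S (advance s z (z \<in> S))"
      using valid_advance[OF sub conv Suc.prems(1) z] .
    show "fuel_needed M (advance s z (z \<in> S)) \<le> int k"
      using fuel_needed_advance[OF Suc.prems(1) z, of "z \<in> S"] Suc.prems(2) by simp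
    show "(if z \<in> S then insert z P else P) \<subseteq> S"
      using Suc.prems(3) by simp
    fix P' assume "(if z \<in> S then insert z P else P) \<subseteq> P'" "P' \<subseteq> S"
    then show "rej f (K P') \<le> \<alpha>' + \<beta> * real (card (missed (pending S (advance s z (z \<in> S))) P'))"
      using that(2)[of P'] Suc.prems(4)[of P'] by (force split: if_splits)
  qed
  have finm: "finite (missed (pending S t) P')" for t P'
    using fin pending_subset[of S t] by (auto simp: missed_def intro: finite_subset)
  show ?case
  proof (cases s)
    case (Walk i a b)
    have "rej f (?next (a, b)) \<le> \<alpha> + \<beta> * (2 * potential M (advance s (a, b) ((a, b) \<in> S)))"
    proof (rule IH)
      fix P' assume "P' \<subseteq> S" "(a, b) \<in> S \<longrightarrow> (a, b) \<in> P'"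
      then have "card (missed (pending S s) P') \<le> card (missed (pending S (advance s (a, b) ((a, b) \<in> S))) P')"
        using missed_Walk[OF conv, of M i a b P' "(a, b)"] Suc.prems(1) Walk
        by (intro card_mono finm) auto
      then show "\<alpha> + \<beta> * real (card (missed (pending S s) P'))
        \<le> \<alpha> + \<beta> * real (card (missed (pending S (advance s (a, b) ((a, b) \<in> S))) P'))"
        using \<open>0 \<le> \<beta>\<close> by (simp add: mult_left_mono)
    qed (simp add: Walk)
    moreover have "\<alpha> + \<beta> * (2 * potential M (advance s (a, b) ((a, b) \<in> S))) \<le> \<alpha> + \<beta> * (2 * potential M s)"
      using \<open>0 \<le> \<beta>\<close> potential_advance_Walk[of M i a b "(a, b)" "(a, b) \<in> S"] Walk
      by (simp add: mult_left_mono del: advance.simps potential.simps)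
    moreover have pr: "probes s = {(a, b)}"
      by (simp add: Walk)
    moreover have "(\<Sum>z\<in>probes s. rej f (?next z)) = rej f (?next (a, b))"
      by (rule trans[OF sum.cong[OF pr refl]]) simp
    ultimately show ?thesis
      unfolding eq by simp
  next
    case (Shell x y R)
    define h where "h = real (card (S \<inter> probes s))"
    define \<phi> where "\<phi> = real_of_int (potential M s)"
    have R: "0 \<le> R"
      using Suc.prems(1) Shell by simp
    have card: "real (card (probes s)) = 2 * R + 1"
      using card_probes_Shell[OF R] Shell by simp
    have "rej f (?next z) \<le> (\<alpha> + \<beta> * h) + \<beta> * (2 * \<phi>) - (if z \<in> S then \<beta> * (2 * R + 1) else 0)"
      if z: "z \<in> probes s" for z
    proof -
      have "rej f (?next z) \<le> (\<alpha> + \<beta> * h) + \<beta> * (2 * potential M (advance s z (z \<in> S)))"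
      proof (rule IH[OF z])
        fix P' assume P': "P' \<subseteq> S" "z \<in> S \<longrightarrow> z \<in> P'"
        have "card (missed (pending S s) P')
          \<le> card (S \<inter> probes s \<union> missed (pending S (advance s z (z \<in> S))) P')"
          using missed_Shell[of z x y R S P'] P' Shell fin z finm
          by (intro card_mono) auto
        also have "\<dots> \<le> card (S \<inter> probes s) + card (missed (pending S (advance s z (z \<in> S))) P')"
          by (rule card_Un_le)
        finally have "real (card (missed (pending S s) P')) \<le> h + card (missed (pending S (advance s z (z \<in> S))) P')"
          by (simp add: h_def)
        then show "\<alpha> + \<beta> * real (card (missed (pending S s) P'))
          \<le> \<alpha> + \<beta> * h + \<beta> * real (card (missed (pending S (advance s z (z \<in> S))) P'))"
          using \<open>0 \<le> \<beta>\<close> by (simp add: mult_left_mono flip: distrib_left)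
      qed
      moreover have "real_of_int (2 * potential M (advance s z (z \<in> S))) \<le> 2 * \<phi> - (if z \<in> S then 2 * R + 1 else 0)"
        using potential_hit_Shell[of z x y R M] z Shell by (auto simp: \<phi>_def simp del: probes.simps)
      ultimately show ?thesis
        using \<open>0 \<le> \<beta>\<close> mult_left_mono[of "real_of_int (2 * potential M (advance s z (z \<in> S)))"
            "2 * \<phi> - (if z \<in> S then 2 * R + 1 else 0)" \<beta>]
        by (auto simp: algebra_simps split: if_splits)
    qed
    \<comment> \<open>Amortization: each of the \<open>2 * R + 1\<close> outcomes is charged
      \<open>\<beta> * h\<close> for the elements given up, and each of the \<open>h\<close> hits is
      credited \<open>\<beta> * (2 * R + 1)\<close>, so the two cancel.\<close>
    then have "(\<Sum>z\<in>probes s. rej f (?next z)) \<le>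
      (\<Sum>z\<in>probes s. (\<alpha> + \<beta> * h) + \<beta> * (2 * \<phi>) - (if z \<in> S then \<beta> * (2 * R + 1) else 0))"
      by (rule sum_mono)
    also have "\<dots> = (2 * R + 1) * ((\<alpha> + \<beta> * h) + \<beta> * (2 * \<phi>)) - h * (\<beta> * (2 * R + 1))"
      by (simp add: sum_subtractf sum.If_cases card h_def Int_commute)
    also have "\<dots> = (2 * R + 1) * (\<alpha> + \<beta> * (2 * \<phi>))"
      by (simp add: algebra_simps)
    finally show ?thesis
      using R unfolding eq card by (simp add: field_simps \<phi>_def)
  qed
qed


lemma rej_bind_ge:
  assumes "\<And>z. c \<le> rej f (D z)"
  shows "c \<le> rej f (bind_pmf p D)"
proof -
  have "c \<le> measure_pmf.expectation p (\<lambda>z. pmf (map_pmf (run f) (D z)) False)"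
    using assms unfolding rej_def
    by (intro measure_pmf.integral_ge_const measure_pmf.integrable_const_bound[where B = 1])
      (auto simp: pmf_le_1)
  then show ?thesis
    by (simp add: rej_def map_bind_pmf pmf_bind)
qed

text \<open>Serves soundness, where the final check must reject whatever points a sweep
  delivers.\<close>

lemma rej_learn_ge:
  assumes "\<And>P. c \<le> rej f (K P)"
  shows "c \<le> rej f (learn M \<rho> K k s P)"
  using assms by (induction k arbitrary: s P) (auto simp: rej_ask intro!: rej_bind_ge)

lemma admissible_learn:
  assumes "\<And>z. z \<in> board M \<Longrightarrow> \<rho> z \<in> A" "\<And>P. admissible A q (K P)"
  shows "admissible A (k + q) (learn M \<rho> K k s P)"
proof (induction k arbitrary: s P)
  case (Suc k)
  have "admissible A (Suc (k + q)) (ask M \<rho> z (\<lambda>b. learn M \<rho> K k (advance s z b)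
      (if b then insert z P else P)))" for z
    using assms(1)[of z] Suc admissible_mono[OF Suc, of "Suc (k + q)"]
    by (auto simp: ask_def intro: admissible_rquery)
  then show ?case
    by (auto intro: admissible_bind)
qed (use assms in simp)

subsection \<open>Comparison with a hypothesis\<close>

primrec verify :: "'b set \<Rightarrow> ('b \<Rightarrow> 'a) \<Rightarrow> ('b \<Rightarrow> bool) \<Rightarrow> nat \<Rightarrow> 'a dtree pmf" where
  "verify \<Omega> \<pi> H 0 = return_pmf (Leaf True)"
| "verify \<Omega> \<pi> H (Suc m) = bind_pmf (pmf_of_set \<Omega>) (\<lambda>u.
     rquery (\<pi> u) (\<lambda>b. if b = H u then verify \<Omega> \<pi> H m else return_pmf (Leaf False)))"

lemma rej_verify:
  assumes "finite \<Omega>" "\<Omega> \<noteq> {}"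
  shows "rej f (verify \<Omega> \<pi> H m) = 1 - (1 - real (card {u \<in> \<Omega>. f (\<pi> u) \<noteq> H u}) / real (card \<Omega>)) ^ m"
proof (induction m)
  case (Suc m)
  let ?B = "{u \<in> \<Omega>. f (\<pi> u) \<noteq> H u}" and ?r = "rej f (verify \<Omega> \<pi> H m)"
  have pos: "real (card \<Omega>) > 0"
    using assms by (simp add: card_gt_0_iff)
  have "rej f (if f (\<pi> u) = H u then verify \<Omega> \<pi> H m else return_pmf (Leaf False))
      = ?r + (if u \<in> ?B then 1 - ?r else 0)" if "u \<in> \<Omega>" for u
    using that by (cases "f (\<pi> u) = H u") simp_all
  then have "rej f (verify \<Omega> \<pi> H (Suc m)) = (\<Sum>u\<in>\<Omega>. ?r + (if u \<in> ?B then 1 - ?r else 0)) / real (card \<Omega>)"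
    using assms by (simp add: rej_bind_pmf_of_set cong: sum.cong)
  also have "(\<Sum>u\<in>\<Omega>. ?r + (if u \<in> ?B then 1 - ?r else 0)) = card \<Omega> * ?r + card ?B * (1 - ?r)"
    using assms(1) by (simp add: sum.distrib sum.If_cases Int_def)
  finally have eq: "rej f (verify \<Omega> \<pi> H (Suc m)) = (card \<Omega> * ?r + card ?B * (1 - ?r)) / card \<Omega>" .
  show ?case
    unfolding eq Suc using pos by (simp add: field_simps)
qed simp

lemma rej_verify_le:
  assumes "finite \<Omega>" "\<Omega> \<noteq> {}"
  shows "rej f (verify \<Omega> \<pi> H m) \<le> real m * (real (card {u \<in> \<Omega>. f (\<pi> u) \<noteq> H u}) / real (card \<Omega>))"
proof -
  define d where "d = real (card {u \<in> \<Omega>. f (\<pi> u) \<noteq> H u}) / real (card \<Omega>)"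
  have "card {u \<in> \<Omega>. f (\<pi> u) \<noteq> H u} \<le> card \<Omega>"
    using assms by (intro card_mono) auto
  then have "d \<le> 1"
    by (auto simp: d_def divide_le_eq_1)
  then show ?thesis
    using Bernoulli_inequality[of "- d" m] unfolding rej_verify[OF assms] d_def[symmetric] by simp
qed

lemma admissible_verify:
  assumes "finite \<Omega>" "\<Omega> \<noteq> {}" "\<And>u. u \<in> \<Omega> \<Longrightarrow> \<pi> u \<in> A"
  shows "admissible A m (verify \<Omega> \<pi> H m)"
proof (induction m)
  case (Suc m)
  have "admissible A (Suc m) (rquery (\<pi> u)
      (\<lambda>b. if b = H u then verify \<Omega> \<pi> H m else return_pmf (Leaf False)))" if "u \<in> \<Omega>" for u
    using assms(3)[OF that] Suc by (auto intro: admissible_rquery)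
  then show ?case
    unfolding verify.simps using assms(1,2) by (intro admissible_bind) simp
qed simp

subsection \<open>Cells\<close>

text \<open>Sites are indexed from 0, grid points and cells from 1. The blow-up makes the cells fit
  evenly, also when \<open>n < M\<close>.\<close>

definition sites :: "nat \<Rightarrow> nat \<Rightarrow> (nat \<times> nat) set" where
  "sites n M = {..<n * M} \<times> {..<n * M}"

text \<open>The square of sites is divided twice: into blocks of side \<open>M\<close>, one for each
  grid point, and into cells of side \<open>n\<close>.\<close>

definition origin :: "nat \<Rightarrow> nat \<times> nat \<Rightarrow> nat \<times> nat" where
  "origin M u = (fst u div M + 1, snd u div M + 1)"

definition cell :: "nat \<Rightarrow> nat \<times> nat \<Rightarrow> int \<times> int" where
  "cell n u = (int (fst u div n) + 1, int (snd u div n) + 1)"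

definition corner :: "nat \<Rightarrow> int \<times> int \<Rightarrow> nat \<times> nat" where
  "corner n z = (nat (fst z - 1) * n, nat (snd z - 1) * n)"

definition reflect :: "nat \<Rightarrow> int \<times> int \<Rightarrow> int \<times> int" where
  "reflect M z = (int M + 1 - fst z, int M + 1 - snd z)"

lemma finite_sites [simp]: "finite (sites n M)"
  by (simp add: sites_def)

lemma card_sites: "card (sites n M) = (n * M)\<^sup>2"
  by (simp add: sites_def power2_eq_square)

lemma origin_in_grid: "u \<in> sites n M \<Longrightarrow> origin M u \<in> grid n"
  by (auto simp: sites_def origin_def grid_def Suc_le_eq less_mult_imp_div_less)

lemma cell_in_board: "u \<in> sites n M \<Longrightarrow> cell n u \<in> board (int M)"
  using less_mult_imp_div_less[of "fst u" M n] less_mult_imp_div_less[of "snd u" M n]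
  by (auto simp: sites_def cell_def board_def mult.commute)

lemma corner_in_sites:
  assumes "z \<in> board (int M)" "0 < n"
  shows "corner n z \<in> sites n M"
  using assms by (auto simp: sites_def corner_def board_def)

lemma cell_corner: "z \<in> board (int M) \<Longrightarrow> 0 < n \<Longrightarrow> cell n (corner n z) = z"
  by (auto simp: cell_def corner_def board_def)

lemma origin_mono: "u \<le> v \<Longrightarrow> origin M u \<le> origin M v"
  by (auto simp: origin_def less_eq_prod_def div_le_mono)

lemma corner_mono: "z \<le> w \<Longrightarrow> corner n z \<le> corner n w"
  by (auto simp: corner_def less_eq_prod_def)

lemma cell_mono: "u \<le> v \<Longrightarrow> cell n u \<le> cell n v"
  by (auto simp: cell_def less_eq_prod_def div_le_mono)

lemma pleq_iff: "pleq x y \<longleftrightarrow> x \<le> y"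
  by (simp add: pleq_def less_eq_prod_def)

lemma two_monotone_sites:
  assumes "two_monotone n f" "u \<in> sites n M" "v \<in> sites n M" "w \<in> sites n M"
    "u \<le> v" "v \<le> w" "f (origin M u)" "f (origin M w)"
  shows "f (origin M v)"
  using assms origin_in_grid origin_mono unfolding two_monotone_def pleq_iff by blast

lemma order_convex_cells:
  assumes "two_monotone n f" "0 < n"
  shows "order_convex {z \<in> board (int M). f (origin M (corner n z))}"
proof -
  have "v \<in> board (int M)" if "u \<in> board (int M)" "w \<in> board (int M)" "u \<le> v" "v \<le> w" for u v w
    using that by (auto simp: board_def less_eq_prod_def mem_Times_iff)
  moreover have "f (origin M (corner n v))"
    if "u \<in> board (int M)" "v \<in> board (int M)" "w \<in> board (int M)" "u \<le> v" "v \<le> w"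
      "f (origin M (corner n u))" "f (origin M (corner n w))" for u v w
    using that two_monotone_sites[OF assms(1) corner_in_sites corner_in_sites corner_in_sites] assms(2)
      corner_mono by blast
  ultimately show ?thesis
    unfolding order_convex_def by blast
qed

lemma reflect_mirror [simp]: "reflect M (reflect M z) = z"
  by (simp add: reflect_def)

lemma reflect_le_iff: "reflect M z \<le> reflect M w \<longleftrightarrow> w \<le> z"
  by (auto simp: reflect_def less_eq_prod_def)

lemma reflect_in_board [simp]: "reflect M z \<in> board (int M) \<longleftrightarrow> z \<in> board (int M)"
  by (auto simp: reflect_def board_def mem_Times_iff)

lemma order_convex_mirror:
  "order_convex S \<Longrightarrow> order_convex {z. reflect M z \<in> S}"
  unfolding order_convex_def by (metis mem_Collect_eq reflect_le_iff)

section \<open>Counting the cells on which a 2-monotone function is not constant\<close>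

lemma card_antichain_le:
  assumes "D \<subseteq> board (int M)"
    and "\<And>z w. z \<in> D \<Longrightarrow> w \<in> D \<Longrightarrow> \<not> (fst z < fst w \<and> snd z < snd w)"
  shows "card D \<le> 2 * M"
proof -
  \<comment> \<open>Distinct cells on one diagonal are strictly comparable, so each of the
    \<open>2 * M - 1\<close> diagonals holds at most one.\<close>
  have "inj_on (\<lambda>z. fst z - snd z) D"
  proof (rule inj_onI)
    fix z w assume zw: "z \<in> D" "w \<in> D" "fst z - snd z = fst w - snd w"
    then show "z = w"
      using assms(2)[of z w] assms(2)[of w z] by (auto simp: prod_eq_iff)
  qed
  moreover have "(\<lambda>z. fst z - snd z) ` D \<subseteq> {1 - int M..int M - 1}"
    using assms(1) by (auto simp: board_def)
  ultimately have "card D \<le> card {1 - int M..int M - 1}"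
    by (intro card_inj_on_le) auto
  then show ?thesis
    by simp
qed

lemma card_no_three_chain_le:
  assumes "C \<subseteq> board (int M)"
    and "\<And>u v w. u \<in> C \<Longrightarrow> v \<in> C \<Longrightarrow> w \<in> C \<Longrightarrow> fst u < fst v \<Longrightarrow> snd u < snd v \<Longrightarrow>
       fst v < fst w \<Longrightarrow> snd v < snd w \<Longrightarrow> False"
  shows "card C \<le> 4 * M"
proof -
  \<comment> \<open>Removing the maximal elements shortens every chain, so both parts are
    antichains.\<close>
  define A where "A = {z \<in> C. \<not> (\<exists>w\<in>C. fst z < fst w \<and> snd z < snd w)}"
  have "card A \<le> 2 * M"
    using assms(1) by (intro card_antichain_le) (auto simp: A_def)
  moreover have "card (C - A) \<le> 2 * M"
  proof (rule card_antichain_le)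
    show "C - A \<subseteq> board (int M)"
      using assms(1) by blast
    show "\<not> (fst z < fst w \<and> snd z < snd w)" if "z \<in> C - A" "w \<in> C - A" for z w
      using that assms(2) unfolding A_def by blast
  qed
  moreover have "card C \<le> card A + card (C - A)"
    using card_Un_le[of A "C - A"] by (simp add: A_def Un_absorb1)
  ultimately show ?thesis
    by simp
qed

definition mixed :: "nat \<Rightarrow> nat \<Rightarrow> (nat \<times> nat \<Rightarrow> bool) \<Rightarrow> (int \<times> int) set" where
  "mixed n M f = {z \<in> board (int M). \<exists>u\<in>sites n M. cell n u = z \<and>
     f (origin M u) \<noteq> f (origin M (corner n z))}"

text \<open>Strictness in both coordinates makes all sites of one cell comparable to all sites of
  the other; hence the use of strict chains.\<close>

lemma le_of_cell_less:
  assumes "fst (cell n u) < fst (cell n v)" "snd (cell n u) < snd (cell n v)"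
  shows "u \<le> v"
proof -
  have "s \<le> t" if "s div n < t div n" for s t :: nat
    using that by (meson div_le_mono leD nat_le_linear)
  then show ?thesis
    using assms by (simp add: cell_def less_eq_prod_def)
qed

lemma card_mixed_le:
  assumes "two_monotone n f" "0 < n"
  shows "card (mixed n M f) \<le> 4 * M"
proof (rule card_no_three_chain_le)
  show "mixed n M f \<subseteq> board (int M)"
    by (auto simp: mixed_def)
  have both: "\<exists>u\<in>sites n M. cell n u = z \<and> f (origin M u) = b" if "z \<in> mixed n M f" for z b
    using that corner_in_sites[OF _ assms(2)] cell_corner[OF _ assms(2)] unfolding mixed_def by blast
  fix c1 c2 c3
  assume c: "c1 \<in> mixed n M f" "c2 \<in> mixed n M f" "c3 \<in> mixed n M f"
    and lt: "fst c1 < fst c2" "snd c1 < snd c2" "fst c2 < fst c3" "snd c2 < snd c3"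
  obtain u v w where "u \<in> sites n M" "cell n u = c1" "f (origin M u)"
    "v \<in> sites n M" "cell n v = c2" "\<not> f (origin M v)"
    "w \<in> sites n M" "cell n w = c3" "f (origin M w)"
    using both[OF c(1), of True] both[OF c(2), of False] both[OF c(3), of True] by auto
  then show False
    using two_monotone_sites[OF assms(1), of u M v w] le_of_cell_less lt by blast
qed

lemma card_cell_vimage_le:
  assumes "B \<subseteq> board (int M)" "0 < n"
  shows "card {u \<in> sites n M. cell n u \<in> B} \<le> n\<^sup>2 * card B"
proof -
  let ?f = "\<lambda>u :: nat \<times> nat. (cell n u, (fst u mod n, snd u mod n))"
  have "finite B"
    using assms(1) by (rule finite_subset) (simp add: board_def)
  have "inj_on ?f {u \<in> sites n M. cell n u \<in> B}"
  proof (rule inj_onI)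
    fix u v assume "?f u = ?f v"
    then show "u = v"
      by (auto simp: cell_def prod_eq_iff) (metis div_mult_mod_eq)+
  qed
  moreover have "?f ` {u \<in> sites n M. cell n u \<in> B} \<subseteq> B \<times> ({..<n} \<times> {..<n})"
    using assms(2) by auto
  ultimately have "card {u \<in> sites n M. cell n u \<in> B} \<le> card (B \<times> ({..<n} \<times> {..<n}))"
    using \<open>finite B\<close> by (intro card_inj_on_le) auto
  then show ?thesis
    by (simp add: card_cartesian_product power2_eq_square mult_ac)
qed

section \<open>The guess and its error\<close>

text \<open>\<open>Q\<close> is given in reflected coordinates.\<close>

definition guess :: "nat \<Rightarrow> nat \<Rightarrow> (int \<times> int) set \<Rightarrow> (int \<times> int) set \<Rightarrow> nat \<times> nat \<Rightarrow> bool" where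
  "guess n M P Q u \<longleftrightarrow> (\<exists>p\<in>P. p \<le> cell n u) \<and> (\<exists>q\<in>Q. q \<le> reflect M (cell n u))"

text \<open>A cell of \<open>S\<close> missed by neither sweep is guessed. Conversely, a guessed
  cell lies between a point of \<open>P\<close> and a reflected point of \<open>Q\<close>, both in
  \<open>S\<close>, so convexity puts it in \<open>S\<close>.\<close>

lemma card_guess_wrong_le:
  assumes f: "two_monotone n f" and n: "0 < n"
    and S: "S = {z \<in> board (int M). f (origin M (corner n z))}"
    and S': "S' = {z \<in> board (int M). f (origin M (corner n (reflect M z)))}"
    and P: "P \<subseteq> S" and Q: "Q \<subseteq> S'"
  shows "card {u \<in> sites n M. f (origin M u) \<noteq> guess n M P Q u}
    \<le> n\<^sup>2 * (4 * M + card (missed S P) + card (missed S' Q))"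
proof -
  let ?B = "mixed n M f \<union> missed S P \<union> reflect M ` missed S' Q"
  have fin: "finite (board (int M))"
    by (simp add: board_def)
  have sub: "?B \<subseteq> board (int M)"
    by (auto simp: mixed_def missed_def S S')
  have wrong: "cell n u \<in> ?B"
    if u: "u \<in> sites n M" "f (origin M u) \<noteq> guess n M P Q u" for u
  proof (rule ccontr)
    let ?z = "cell n u"
    assume nB: "?z \<notin> ?B"
    have z: "?z \<in> board (int M)"
      using cell_in_board[OF u(1)] .
    have fu: "f (origin M u) \<longleftrightarrow> ?z \<in> S"
      using nB u(1) z by (auto simp: mixed_def S)
    have "reflect M ?z \<notin> missed S' Q"
      using nB reflect_mirror[of M ?z] by (metis UnI2 imageI)
    then have "guess n M P Q u" if "?z \<in> S"
      using nB z that by (auto simp: guess_def missed_def S S')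
    moreover have "?z \<in> S" if g: "guess n M P Q u"
    proof -
      obtain p q where pq: "p \<in> P" "p \<le> ?z" "q \<in> Q" "q \<le> reflect M ?z"
        using g unfolding guess_def by blast
      have "?z \<le> reflect M q"
        using pq(4) reflect_le_iff[of M "reflect M q" ?z] by simp
      moreover have "reflect M q \<in> S"
        using pq(3) Q by (auto simp: S S')
      moreover have "p \<in> S"
        using pq(1) P by blast
      ultimately show ?thesis
        using order_convexD[OF order_convex_cells[OF f n, of M, folded S], of p "reflect M q" ?z] pq(2)
        by blast
    qed
    ultimately show False
      using u(2) fu by blast
  qed
  have "card {u \<in> sites n M. f (origin M u) \<noteq> guess n M P Q u} \<le> card {u \<in> sites n M. cell n u \<in> ?B}"
    using wrong by (intro card_mono) auto
  also have "\<dots> \<le> n\<^sup>2 * card ?B"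
    by (rule card_cell_vimage_le[OF sub n])
  also have "card ?B \<le> card (mixed n M f) + card (missed S P) + card (reflect M ` missed S' Q)"
    using card_Un_le[of "mixed n M f \<union> missed S P" "reflect M ` missed S' Q"]
      card_Un_le[of "mixed n M f" "missed S P"] by linarith
  also have "\<dots> \<le> 4 * M + card (missed S P) + card (missed S' Q)"
    using card_mixed_le[OF f n, of M] fin
    by (intro add_mono card_image_le) (auto simp: S' missed_def intro: finite_subset)
  finally show ?thesis
    by simp
qed

lemma guess_convex:
  assumes "guess n M P Q u" "guess n M P Q w" "u \<le> v" "v \<le> w"
  shows "guess n M P Q v"
  using assms cell_mono[of u v n] cell_mono[of v w n] unfolding guess_def
  by (meson reflect_le_iff order_trans)

text \<open>The sites with fixed offsets inside the blown-up points form a copy of the grid, on which the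
  guess is 2-monotone; average over the offsets.\<close>

lemma far_sites:
  assumes far: "far_from_two_monotone n \<epsilon> f" and n: "0 < n"
  shows "\<epsilon> * real ((n * M)\<^sup>2) \<le> real (card {u \<in> sites n M. f (origin M u) \<noteq> guess n M P Q u})"
proof -
  define lift where "lift = (\<lambda>(x :: nat \<times> nat, a :: nat \<times> nat).
    ((fst x - 1) * M + fst a, (snd x - 1) * M + snd a))"
  define J where "J = {..<M} \<times> {..<M}"
  define W where "W = (\<lambda>a. {x \<in> grid n. f x \<noteq> guess n M P Q (lift (x, a))})"
  have W: "\<epsilon> * real (n\<^sup>2) \<le> real (card (W a))" for a
  proof -
    have "lift (x, a) \<le> lift (y, a)" if "x \<le> y" for x y
      using that by (auto simp: lift_def less_eq_prod_def intro!: mult_le_mono1)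
    then have "two_monotone n (\<lambda>x. guess n M P Q (lift (x, a)))"
      unfolding two_monotone_def pleq_iff using guess_convex by blast
    then have "\<epsilon> \<le> hdist n f (\<lambda>x. guess n M P Q (lift (x, a)))"
      using far by (simp add: far_from_two_monotone_def)
    then show ?thesis
      using n by (simp add: hdist_def W_def grid_def power2_eq_square field_simps)
  qed
  have origin_lift: "origin M (lift (x, a)) = x" "fst (lift (x, a)) mod M = fst a"
    "snd (lift (x, a)) mod M = snd a" if "x \<in> grid n" "a \<in> J" for x a
    using that by (auto simp: origin_def lift_def J_def grid_def)
  have lift_sites: "lift (x, a) \<in> sites n M" if "x \<in> grid n" "a \<in> J" for x a
  proof -
    have "(i - 1) * M + j < n * M" if "i \<le> n" "1 \<le> i" "j < M" for i j
    proof -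
      have "(i - 1) * M + j < (i - 1) * M + 1 * M"
        using that by simp
      also have "\<dots> = i * M"
        using that by (cases i) auto
      finally show ?thesis
        using that(1) by (meson less_le_trans mult_le_mono1)
    qed
    then show ?thesis
      using that by (auto simp: lift_def sites_def J_def grid_def)
  qed
  \<comment> \<open>\<open>origin\<close> recovers the grid point and the residues modulo
    \<open>M\<close> recover the offsets.\<close>
  have "inj_on (\<lambda>(a, x). lift (x, a)) (Sigma J W)"
  proof (rule inj_onI, clarify)
    fix a1 a2 x1 x2 b1 b2 y1 y2
    assume *: "(a1, a2) \<in> J" "(x1, x2) \<in> W (a1, a2)" "(b1, b2) \<in> J" "(y1, y2) \<in> W (b1, b2)"
      "lift ((x1, x2), (a1, a2)) = lift ((y1, y2), (b1, b2))"
    have "(x1, x2) \<in> grid n" "(y1, y2) \<in> grid n"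
      using *(2,4) by (auto simp: W_def)
    then show "(a1, a2) = (b1, b2) \<and> (x1, x2) = (y1, y2)"
      using origin_lift[of "(x1, x2)" "(a1, a2)"] origin_lift[of "(y1, y2)" "(b1, b2)"] *(1,3,5)
      by auto
  qed
  moreover have "(\<lambda>(a, x). lift (x, a)) ` Sigma J W \<subseteq> {u \<in> sites n M. f (origin M u) \<noteq> guess n M P Q u}"
    using origin_lift(1) lift_sites by (fastforce simp: W_def)
  ultimately have "card (Sigma J W) \<le> card {u \<in> sites n M. f (origin M u) \<noteq> guess n M P Q u}"
    by (intro card_inj_on_le) auto
  moreover have "card (Sigma J W) = (\<Sum>a\<in>J. card (W a))"
    by (rule card_SigmaI) (auto simp: J_def W_def grid_def)
  moreover have "(\<Sum>a\<in>J. \<epsilon> * real (n\<^sup>2)) \<le> (\<Sum>a\<in>J. real (card (W a)))"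
    by (rule sum_mono) (rule W)
  moreover have "(\<Sum>a\<in>J. \<epsilon> * real (n\<^sup>2)) = \<epsilon> * real ((n * M)\<^sup>2)"
    by (simp add: J_def power2_eq_square)
  ultimately show ?thesis
    by (simp only: of_nat_le_iff[where 'a = real, symmetric] of_nat_sum)
qed

subsection \<open>The tester\<close>

text \<open>The fuel \<open>4 * M\<close> is \<open>fuel_needed\<close> at the upper left
  corner.\<close>

definition tester :: "nat \<Rightarrow> nat \<Rightarrow> nat \<Rightarrow> (nat \<times> nat) dtree pmf" where
  "tester n M N =
     learn (int M) (\<lambda>z. origin M (corner n z)) (\<lambda>P.
       learn (int M) (\<lambda>z. origin M (corner n (reflect M z))) (\<lambda>Q.
         verify (sites n M) (origin M) (guess n M P Q) N)
       (4 * M) (Shell 1 (int M) 0) {})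
     (4 * M) (Shell 1 (int M) 0) {}"

lemma sites_nonempty: "0 < n \<Longrightarrow> 0 < M \<Longrightarrow> sites n M \<noteq> {}"
  by (simp add: sites_def lessThan_empty_iff)

lemma admissible_tester:
  assumes "0 < n" "0 < M"
  shows "admissible (grid n) (8 * M + N) (tester n M N)"
proof -
  have "admissible (grid n) (4 * M + (4 * M + N)) (tester n M N)"
    unfolding tester_def using assms
    by (intro admissible_learn admissible_verify)
      (simp_all add: origin_in_grid corner_in_sites sites_nonempty)
  then show ?thesis
    by simp
qed

text \<open>The 12 is 4 for the mixed cells plus 4 for each sweep, whose initial potential is
  \<open>2 * M\<close>.\<close>

lemma rej_tester_le:
  assumes f: "two_monotone n f" and n: "0 < n" and M: "0 < M"
  shows "rej f (tester n M N) \<le> 12 * real N / real M"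
proof -
  define S where "S = {z \<in> board (int M). f (origin M (corner n z))}"
  define S' where "S' = {z \<in> board (int M). f (origin M (corner n (reflect M z)))}"
  \<comment> \<open>The price of one wrong cell: \<open>N\<close> samples, each in a given cell with
    probability \<open>1 / M\<^sup>2\<close>.\<close>
  define \<beta> where "\<beta> = real N / (real M)\<^sup>2"
  have beta: "0 \<le> \<beta>"
    by (simp add: \<beta>_def)
  have conv: "order_convex S"
    unfolding S_def by (rule order_convex_cells[OF f n])
  have "S' = {z. reflect M z \<in> S}"
    by (auto simp: S_def S'_def)
  then have conv': "order_convex S'"
    using order_convex_mirror[OF conv] by simp
  have missed_start: "missed (pending A (Shell 1 (int M) 0)) P = missed A P"
    if "A \<subseteq> board (int M)" for A P
    using that by (auto simp: missed_def board_def)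
  have "rej f (verify (sites n M) (origin M) (guess n M P Q) N)
      \<le> (\<beta> * (4 * M) + \<beta> * card (missed S P)) + \<beta> * card (missed S' Q)"
    if "P \<subseteq> S" "Q \<subseteq> S'" for P Q
  proof -
    have "rej f (verify (sites n M) (origin M) (guess n M P Q) N)
        \<le> real N * (real (card {u \<in> sites n M. f (origin M u) \<noteq> guess n M P Q u}) / real ((n * M)\<^sup>2))"
      using rej_verify_le[OF finite_sites sites_nonempty[OF n M]] by (simp add: card_sites)
    also have "\<dots> \<le> real N * (real (n\<^sup>2 * (4 * M + card (missed S P) + card (missed S' Q))) / real ((n * M)\<^sup>2))"
      using card_guess_wrong_le[OF f n S_def S'_def that]
      by (intro mult_left_mono divide_right_mono) (simp_all only: of_nat_le_iff of_nat_0_le_iff)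
    also have "\<dots> = \<beta> * (4 * M + card (missed S P) + card (missed S' Q))"
      using n M by (simp add: \<beta>_def power_mult_distrib)
    finally show ?thesis
      by (simp add: algebra_simps)
  qed
  \<comment> \<open>With \<open>P\<close> fixed, the loss of the first sweep belongs to the \<alpha>
    of the second.\<close>
  then have "rej f (learn (int M) (\<lambda>z. origin M (corner n (reflect M z))) (\<lambda>Q.
         verify (sites n M) (origin M) (guess n M P Q) N) (4 * M) (Shell 1 (int M) 0) {})
      \<le> (\<beta> * (4 * M) + \<beta> * card (missed S P))
         + \<beta> * (2 * potential (int M) (Shell 1 (int M) 0))" if "P \<subseteq> S" for P
    using that missed_start[of S']
    by (intro rej_learn[where f = f and \<rho> = "\<lambda>z. origin M (corner n (reflect M z))",
          OF S'_def conv' beta]) (auto simp: S'_def)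
  then have "rej f (tester n M N)
      \<le> (\<beta> * (4 * M) + \<beta> * (4 * M)) + \<beta> * (2 * potential (int M) (Shell 1 (int M) 0))"
    unfolding tester_def using missed_start[of S]
    by (intro rej_learn[where f = f and \<rho> = "\<lambda>z. origin M (corner n z)", OF S_def conv beta]) (auto simp: S_def algebra_simps)
  also have "\<dots> = 12 * real N / real M"
    using M by (simp add: \<beta>_def field_simps power2_eq_square)
  finally show ?thesis .
qed

lemma rej_tester_ge:
  assumes far: "far_from_two_monotone n \<epsilon> f" and n: "0 < n" and M: "0 < M"
    and eps: "0 < \<epsilon>" and N: "2 / \<epsilon> \<le> real N"
  shows "2 / 3 \<le> rej f (tester n M N)"
  unfolding tester_def
proof (intro rej_learn_ge)
  fix P Q
  define d where "d = real (card {u \<in> sites n M. f (origin M u) \<noteq> guess n M P Q u}) / real (card (sites n M))"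
  have "\<epsilon> \<le> d"
    using far_sites[OF far n, of M P Q] n M by (simp add: d_def card_sites field_simps)
  have "card {u \<in> sites n M. f (origin M u) \<noteq> guess n M P Q u} \<le> card (sites n M)"
    by (intro card_mono) auto
  then have "d \<le> 1"
    by (auto simp: d_def divide_le_eq_1)
  have "(1 - d) ^ N \<le> exp (- d) ^ N"
    using \<open>d \<le> 1\<close> exp_ge_add_one_self[of "- d"] by (intro power_mono) auto
  also have "\<dots> = exp (- (N * d))"
    by (simp flip: exp_of_nat_mult)
  also have "\<dots> \<le> exp (- 2)"
  proof -
    have "2 \<le> N * \<epsilon>"
      using N eps by (simp add: field_simps)
    also have "\<dots> \<le> N * d"
      using \<open>\<epsilon> \<le> d\<close> by (simp add: mult_left_mono)
    finally show ?thesis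
      by simp
  qed
  also have "\<dots> \<le> 1 / 3"
    using exp_ge_add_one_self[of 2] by (simp add: exp_minus field_simps)
  finally show "2 / 3 \<le> rej f (verify (sites n M) (origin M) (guess n M P Q) N)"
    unfolding rej_verify[OF finite_sites sites_nonempty[OF n M]] d_def[symmetric] by simp
qed

theorem theorem1p6:
  shows "\<exists>T C. C > 0 \<and> is_two_monotone_tester T \<and>
           query_bound T (\<lambda>n \<epsilon>. C / \<epsilon>)"
proof -
  \<comment> \<open>As \<open>N \<epsilon> \<le> 3 / \<epsilon>\<close>, the choice
    \<open>108 = 3 * 12 * 3\<close> makes \<open>12 * N \<epsilon> / M \<epsilon>\<close> at most
    1/3.\<close>
  define M where "M = (\<lambda>\<epsilon> :: real. nat \<lceil>108 / \<epsilon>\<rceil>)"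
  define N where "N = (\<lambda>\<epsilon> :: real. nat \<lceil>2 / \<epsilon>\<rceil>)"
  define T where "T = (\<lambda>n \<epsilon>. if n = 0 then return_pmf (Leaf True) else tester n (M \<epsilon>) (N \<epsilon>))"
  have bounds: "108 / \<epsilon> \<le> M \<epsilon>" "M \<epsilon> \<le> 109 / \<epsilon>" "2 / \<epsilon> \<le> N \<epsilon>" "N \<epsilon> \<le> 3 / \<epsilon>" "0 < M \<epsilon>"
    if "0 < \<epsilon>" "\<epsilon> \<le> 1" for \<epsilon>
  proof -
    have "1 \<le> 1 / \<epsilon>"
      using that by simp
    moreover have "real (nat \<lceil>c / \<epsilon>\<rceil>) \<le> c / \<epsilon> + 1" "c / \<epsilon> \<le> real (nat \<lceil>c / \<epsilon>\<rceil>)" if "0 < c" for c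
      using that \<open>0 < \<epsilon>\<close> by (auto simp: of_nat_ceiling)
    note this[of 108] this[of 2]
    ultimately show "108 / \<epsilon> \<le> M \<epsilon>" "M \<epsilon> \<le> 109 / \<epsilon>" "2 / \<epsilon> \<le> N \<epsilon>" "N \<epsilon> \<le> 3 / \<epsilon>"
      by (simp_all add: M_def N_def field_simps)
    show "0 < M \<epsilon>"
      using that by (simp add: M_def)
  qed
  have adm: "admissible (grid n) (8 * M \<epsilon> + N \<epsilon>) (T n \<epsilon>)" if "0 < \<epsilon>" "\<epsilon> \<le> 1" for n \<epsilon>
    using admissible_tester bounds(5)[OF that] by (simp add: T_def)
  have "is_two_monotone_tester T"
    unfolding is_two_monotone_tester_def prob_accept prob_reject
  proof (intro allI impI, elim conjE, intro conjI allI impI ballI)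
    fix n \<epsilon> f t assume eps: "0 < \<epsilon>" "\<epsilon> \<le> (1 :: real)" and "t \<in> set_pmf (T n \<epsilon>)"
    then show "queries_within (grid n) f t"
      using adm[OF eps] by (simp add: admissible_def)
  next
    fix n \<epsilon> f assume eps: "0 < \<epsilon>" "\<epsilon> \<le> (1 :: real)" and f: "two_monotone n f"
    have "12 * real (N \<epsilon>) / real (M \<epsilon>) \<le> 1 / 3"
    proof -
      have "12 * real (N \<epsilon>) \<le> 1 / 3 * (108 / \<epsilon>)"
        using bounds(4)[OF eps] by simp
      also have "\<dots> \<le> 1 / 3 * real (M \<epsilon>)"
        using bounds(1)[OF eps] by simp
      finally show ?thesis
        using bounds(5)[OF eps] by (simp add: field_simps)
    qed
    then have "rej f (tester n (M \<epsilon>) (N \<epsilon>)) \<le> 1 / 3" if "0 < n"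
      using rej_tester_le[OF f that bounds(5)[OF eps], of "N \<epsilon>"] by linarith
    then show "2 / 3 \<le> 1 - rej f (T n \<epsilon>)"
      by (auto simp: T_def)
  next
    fix n \<epsilon> f assume eps: "0 < \<epsilon>" "\<epsilon> \<le> (1 :: real)" and far: "far_from_two_monotone n \<epsilon> f"
    \<comment> \<open>For \<open>n = 0\<close> the distance is \<open>0 / 0 = 0\<close>, so no
      function is far.\<close>
    have "n \<noteq> 0"
    proof
      assume "n = 0"
      moreover have "two_monotone n (\<lambda>_. True)"
        by (simp add: two_monotone_def)
      ultimately show False
        using far eps by (auto simp: far_from_two_monotone_def hdist_def grid_def)
    qed
    then show "2 / 3 \<le> rej f (T n \<epsilon>)"
      using rej_tester_ge[OF far _ bounds(5)[OF eps] eps(1) bounds(3)[OF eps]] by (simp add: T_def)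
  qed
  \<comment> \<open>\<open>875 = 8 * 109 + 3\<close>, for two sweeps of
    \<open>4 * M \<epsilon>\<close> steps and \<open>N \<epsilon>\<close> samples.\<close>
  moreover have "query_bound T (\<lambda>n \<epsilon>. 875 / \<epsilon>)"
    unfolding query_bound_def
  proof (intro allI impI ballI, elim conjE)
    fix n \<epsilon> t f assume t: "t \<in> set_pmf (T n \<epsilon>)" and eps: "0 < \<epsilon>" "\<epsilon> \<le> (1 :: real)"
    have "num_queries f t \<le> 8 * M \<epsilon> + N \<epsilon>"
      using adm[OF eps] t by (simp add: admissible_def)
    then have "real (num_queries f t) \<le> 8 * real (M \<epsilon>) + real (N \<epsilon>)"
      by (metis of_nat_add of_nat_le_iff of_nat_mult of_nat_numeral)
    also have "\<dots> \<le> 875 / \<epsilon>"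
      using bounds(2,4)[OF eps] by simp
    finally show "real (num_queries f t) \<le> 875 / \<epsilon>" .
  qed
  ultimately show ?thesis
    by (intro exI[of _ T] exI[of _ 875]) simp
qed

end
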